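(* The bi-confluent Heun equation $$u''(x)-\left(-\frac1x+\sqrt2\,t+x\right)u'(x)+\frac{4\sqrt3\,n^{3/2}}{9x}\,u(x)=0$$ can be transformed (by the method of isomonodromic deformations with respect to $t$) into a Painlevé IV equation.
   Context: Here $n$ is a positive integer (the degree of an orthogonal polynomial) and $t\in\mathbb R$ is a parameter. The equation arises from the polynomials orthogonal with respect to the Gaussian weight with a single jump, $e^{-x^2}(A_0+B_0\theta(x-t))$ on $\mathbb R$, where $\theta$ is the Heaviside step function and $A_0,B_0$ are constants. "Transformed" refers to the following method of isomonodromic deformations. Write the equation as $\sigma u''+\tau u'+\eta u=0$ with $\sigma,\tau,\eta$ polynomials in $x$ that may depend on $t$. Introduce additional parameters $\lambda,\mu$ with $\sigma(\lambda)\ne0$, and the deformed equation $$\sigma(x)\varphi''+\left(\tau(x)-\frac{\sigma(x)}{x-\lambda}\right)\varphi'+\left(\eta(x)-\eta(\lambda)-\mu\big(\tau(\lambda)-\sigma'(\lambda)\big)-\mu^2\sigma(\lambda)+\frac{\mu\,\sigma(\lambda)}{x-\lambda}\right)\varphi=0,$$ which has an additional non-logarithmic singularity at $x=\lambda$. Let $\lambda,\mu$ depend on $t$ and require the deformed equation to be compatible with an equation $\partial_t\varphi=a(x,t)\,\partial_x\varphi+b(x,t)\,\varphi$ for suitable compatibility functions $a,b$. This compatibility is expressed by a Hamiltonian system $\dot\lambda=\partial H/\partial\mu$, $\dot\mu=-\partial H/\partial\lambda$. Eliminating $\mu$ gives a second order equation for $\lambda$, which is to be a Painlevé equation, possibly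 after a change of variables. The Painlevé IV equation with parameters $(A,B)$ is $$\frac{d^2y}{dt^2}=\frac1{2y}\left(\frac{dy}{dt}\right)^2+\frac32y^3+4ty^2+2(t^2-A)y+\frac{B}{y}.$$ *)

theory Defs
  imports "HOL-Analysis.Analysis" "HOL-Computational_Algebra.Polynomial"
begin

text \<open>
  Conventions: the deformation parameter \<open>t\<close> is real; the independent variable \<open>x\<close> and the
  deformation variables \<open>\<lambda>\<close>, \<open>\<mu>\<close> are complex. A monic equation \<open>u'' + p u' + q u = 0\<close> depending on
  \<open>t\<close> is given by its coefficients \<open>p t x\<close> and \<open>q t x\<close>.
\<close>

text \<open>
  The polynomial form \<open>\<sigma> u'' + \<tau> u' + \<eta> u = 0\<close> of \<open>u'' + p u' + q u = 0\<close>. For each \<open>t\<close>, the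
  absence of a common root of \<open>\<sigma>\<close>, \<open>\<tau>\<close>, \<open>\<eta>\<close> makes the form unique up to a nonzero constant factor;
  such a factor does not affect the deformed equation below.
\<close>

definition polynomial_form ::
  "(real \<Rightarrow> complex \<Rightarrow> complex) \<Rightarrow> (real \<Rightarrow> complex \<Rightarrow> complex) \<Rightarrow>
   (real \<Rightarrow> complex poly) \<Rightarrow> (real \<Rightarrow> complex poly) \<Rightarrow> (real \<Rightarrow> complex poly) \<Rightarrow> bool" where
  "polynomial_form p q \<sigma> \<tau> \<eta> \<longleftrightarrow>
     (\<forall>t. \<sigma> t \<noteq> 0 \<and>
          \<not> (\<exists>x. poly (\<sigma> t) x = 0 \<and> poly (\<tau> t) x = 0 \<and> poly (\<eta> t) x = 0) \<and>
          (\<forall>x. poly (\<sigma> t) x \<noteq> 0 \<longrightarrow>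
             p t x = poly (\<tau> t) x / poly (\<sigma> t) x \<and> q t x = poly (\<eta> t) x / poly (\<sigma> t) x))"

text \<open>
  Coefficients of \<open>\<phi>'\<close> and \<open>\<phi>\<close> in the deformed equation after division by \<open>\<sigma>(x)\<close>; here
  \<open>S\<close>, \<open>T\<close>, \<open>E\<close> are \<open>\<sigma>\<close>, \<open>\<tau>\<close>, \<open>\<eta>\<close> at a fixed \<open>t\<close>, and \<open>l\<close>, \<open>m\<close> are the values of \<open>\<lambda>\<close>, \<open>\<mu>\<close>.
\<close>

definition deformed_p :: "complex poly \<Rightarrow> complex poly \<Rightarrow> complex \<Rightarrow> complex \<Rightarrow> complex" where
  "deformed_p S T l x = (poly T x - poly S x / (x - l)) / poly S x"

definition deformed_q ::
  "complex poly \<Rightarrow> complex poly \<Rightarrow> complex poly \<Rightarrow> complex \<Rightarrow> complex \<Rightarrow> complex \<Rightarrow> complex" where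
  "deformed_q S T E l m x =
     (poly E x - poly E l - m * (poly T l - poly (pderiv S) l) - m\<^sup>2 * poly S l
        + m * poly S l / (x - l)) / poly S x"

text \<open>
  Compatibility of \<open>\<phi>\<^sub>x\<^sub>x + p \<phi>\<^sub>x + q \<phi> = 0\<close> with \<open>\<phi>\<^sub>t = a \<phi>\<^sub>x + b \<phi>\<close> is the equality
  \<open>\<partial>\<^sub>t (\<phi>\<^sub>x\<^sub>x) = \<partial>\<^sub>x\<^sup>2 (\<phi>\<^sub>t)\<close> of cross derivatives, computed from the two equations and required
  identically in \<open>\<phi>\<close> and \<open>\<phi>\<^sub>x\<close>. A pair \<open>(f, g)\<close> stands for the expression \<open>f \<phi> + g \<phi>\<^sub>x\<close>, and
  \<open>diff_x\<close>, \<open>diff_t\<close> are its derivatives reduced again to this form; \<open>diff_t\<close> uses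
  \<open>\<phi>\<^sub>x\<^sub>t = \<partial>\<^sub>x (b \<phi> + a \<phi>\<^sub>x)\<close>.
\<close>

type_synonym jet = "(real \<Rightarrow> complex \<Rightarrow> complex) \<times> (real \<Rightarrow> complex \<Rightarrow> complex)"

definition diff_x ::
  "(real \<Rightarrow> complex \<Rightarrow> complex) \<Rightarrow> (real \<Rightarrow> complex \<Rightarrow> complex) \<Rightarrow> jet \<Rightarrow> jet" where
  "diff_x p q F = (case F of (f, g) \<Rightarrow>
     ((\<lambda>t x. deriv (f t) x - q t x * g t x),
      (\<lambda>t x. deriv (g t) x + f t x - p t x * g t x)))"

definition diff_t ::
  "(real \<Rightarrow> complex \<Rightarrow> complex) \<Rightarrow> (real \<Rightarrow> complex \<Rightarrow> complex) \<Rightarrow>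
   (real \<Rightarrow> complex \<Rightarrow> complex) \<Rightarrow> (real \<Rightarrow> complex \<Rightarrow> complex) \<Rightarrow> jet \<Rightarrow> jet" where
  "diff_t p q a b F = (case F of (f, g) \<Rightarrow> (case diff_x p q (b, a) of (f1, g1) \<Rightarrow>
     ((\<lambda>t x. vector_derivative (\<lambda>s. f s x) (at t) + f t x * b t x + g t x * f1 t x),
      (\<lambda>t x. vector_derivative (\<lambda>s. g s x) (at t) + f t x * a t x + g t x * g1 t x))))"

definition compatible_at ::
  "(real \<Rightarrow> complex \<Rightarrow> complex) \<Rightarrow> (real \<Rightarrow> complex \<Rightarrow> complex) \<Rightarrow>
   (real \<Rightarrow> complex \<Rightarrow> complex) \<Rightarrow> (real \<Rightarrow> complex \<Rightarrow> complex) \<Rightarrow> real \<Rightarrow> complex \<Rightarrow> bool" where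
  "compatible_at p q a b t x \<longleftrightarrow>
     (let F = diff_t p q a b ((\<lambda>t x. - q t x), (\<lambda>t x. - p t x));
          G = diff_x p q (diff_x p q (b, a))
      in fst F t x = fst G t x \<and> snd F t x = snd G t x)"

lemma diff_x_correct:
  fixes \<phi> \<phi>' :: "complex \<Rightarrow> complex"
  assumes "(\<phi> has_field_derivative \<phi>' x) (at x)"
    and "(\<phi>' has_field_derivative - p t x * \<phi>' x - q t x * \<phi> x) (at x)"
    and "f t field_differentiable at x" and "g t field_differentiable at x"
  shows "((\<lambda>x. f t x * \<phi> x + g t x * \<phi>' x) has_field_derivative
           fst (diff_x p q (f, g)) t x * \<phi> x + snd (diff_x p q (f, g)) t x * \<phi>' x) (at x)"
proof -
  have "(f t has_field_derivative deriv (f t) x) (at x)"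
    "(g t has_field_derivative deriv (g t) x) (at x)"
    using assms(3,4) by (simp_all add: DERIV_deriv_iff_field_differentiable)
  from DERIV_add[OF DERIV_mult[OF this(1) assms(1)] DERIV_mult[OF this(2) assms(2)]]
  show ?thesis
    by (rule DERIV_cong) (simp add: diff_x_def algebra_simps)
qed

lemma diff_t_correct:
  fixes \<phi> \<phi>x :: "real \<Rightarrow> complex \<Rightarrow> complex"
  assumes "((\<lambda>s. \<phi> s x) has_vector_derivative a t x * \<phi>x t x + b t x * \<phi> t x) (at t)"
    and "((\<lambda>s. \<phi>x s x) has_vector_derivative
           fst (diff_x p q (b, a)) t x * \<phi> t x + snd (diff_x p q (b, a)) t x * \<phi>x t x) (at t)"
    and "(\<lambda>s. f s x) differentiable at t" and "(\<lambda>s. g s x) differentiable at t"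
  shows "((\<lambda>s. f s x * \<phi> s x + g s x * \<phi>x s x) has_vector_derivative
           fst (diff_t p q a b (f, g)) t x * \<phi> t x + snd (diff_t p q a b (f, g)) t x * \<phi>x t x)
         (at t)"
proof -
  have d: "((\<lambda>s. f s x) has_vector_derivative vector_derivative (\<lambda>s. f s x) (at t)) (at t)"
    "((\<lambda>s. g s x) has_vector_derivative vector_derivative (\<lambda>s. g s x) (at t)) (at t)"
    using assms(3,4) by (simp_all add: vector_derivative_works)
  show ?thesis
    using has_vector_derivative_add[OF has_vector_derivative_mult[OF d(1) assms(1)]
        has_vector_derivative_mult[OF d(2) assms(2)]]
    by (simp add: diff_t_def diff_x_def algebra_simps)
qed

definition hamiltonian_system ::
  "(complex \<Rightarrow> complex \<Rightarrow> real \<Rightarrow> complex) \<Rightarrow> real set \<Rightarrow> (real \<Rightarrow> complex) \<Rightarrow> (real \<Rightarrow> complex) \<Rightarrow> bool"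
where
  "hamiltonian_system H I lam mu \<longleftrightarrow>
     (\<forall>t\<in>I. \<exists>H\<^sub>l H\<^sub>m.
        ((\<lambda>l. H l (mu t) t) has_field_derivative H\<^sub>l) (at (lam t)) \<and>
        ((\<lambda>m. H (lam t) m t) has_field_derivative H\<^sub>m) (at (mu t)) \<and>
        (lam has_vector_derivative H\<^sub>m) (at t) \<and>
        (mu has_vector_derivative - H\<^sub>l) (at t))"

definition painleve_IV ::
  "complex \<Rightarrow> complex \<Rightarrow> real set \<Rightarrow> (real \<Rightarrow> complex) \<Rightarrow> bool" where
  "painleve_IV A B I y \<longleftrightarrow>
     (\<exists>y' y''. \<forall>t\<in>I. y t \<noteq> 0 \<and>
        (y has_vector_derivative y' t) (at t) \<and>
        (y' has_vector_derivative y'' t) (at t) \<and>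
        y'' t = 1 / (2 * y t) * (y' t)\<^sup>2 + 3 / 2 * (y t)^3 + 4 * of_real t * (y t)\<^sup>2
                + 2 * ((of_real t)\<^sup>2 - A) * y t + B / y t)"

definition rational_on :: "complex set \<Rightarrow> (complex \<Rightarrow> complex) \<Rightarrow> bool" where
  "rational_on D f \<longleftrightarrow>
     (\<exists>P Q :: complex poly. \<forall>x\<in>D. poly Q x \<noteq> 0 \<and> f x = poly P x / poly Q x)"

text \<open>
  The method of isomonodromic deformations turns \<open>u'' + p u' + q u = 0\<close> into a Painleve IV equation.
  The compatibility functions are universal functions \<open>a l m t x\<close>, \<open>b l m t x\<close> of \<open>x\<close>, \<open>t\<close> and the
  values \<open>l\<close>, \<open>m\<close> of \<open>\<lambda>\<close>, \<open>\<mu>\<close>. They are required to be rational in \<open>x\<close>, with poles only at the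
  singular points of the deformed equation, since multivalued compatibility functions would not
  preserve the monodromy. The last conjunct is the elimination of \<open>\<mu>\<close>: the functions \<open>\<lambda>\<close> occurring
  in solutions of the Hamiltonian system are exactly those for which \<open>c \<lambda>\<close> solves Painleve IV, where
  the change of variables is a scaling of the dependent variable by a constant.
\<close>

definition isomonodromic_painleve_IV ::
  "(real \<Rightarrow> complex \<Rightarrow> complex) \<Rightarrow> (real \<Rightarrow> complex \<Rightarrow> complex) \<Rightarrow> bool" where
  "isomonodromic_painleve_IV p q \<longleftrightarrow>
     (\<exists>\<sigma> \<tau> \<eta>. polynomial_form p q \<sigma> \<tau> \<eta> \<and>
       (\<exists>a b H.
         (\<forall>l m t. poly (\<sigma> t) l \<noteq> 0 \<longrightarrow>
            rational_on {x. poly (\<sigma> t) x \<noteq> 0 \<and> x \<noteq> l} (a l m t) \<and>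
            rational_on {x. poly (\<sigma> t) x \<noteq> 0 \<and> x \<noteq> l} (b l m t)) \<and>
         (\<forall>I lam mu. open I \<longrightarrow> (\<forall>t\<in>I. poly (\<sigma> t) (lam t) \<noteq> 0) \<longrightarrow>
            (\<forall>t\<in>I. lam differentiable at t \<and> mu differentiable at t) \<longrightarrow>
            ((\<forall>t\<in>I. \<forall>x. poly (\<sigma> t) x \<noteq> 0 \<longrightarrow> x \<noteq> lam t \<longrightarrow>
                compatible_at
                  (\<lambda>t. deformed_p (\<sigma> t) (\<tau> t) (lam t))
                  (\<lambda>t. deformed_q (\<sigma> t) (\<tau> t) (\<eta> t) (lam t) (mu t))
                  (\<lambda>t. a (lam t) (mu t) t) (\<lambda>t. b (lam t) (mu t) t) t x)
             \<longleftrightarrow> hamiltonian_system H I lam mu)) \<and>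
         (\<exists>A B c. c \<noteq> 0 \<and>
            (\<forall>I lam. open I \<longrightarrow> (\<forall>t\<in>I. poly (\<sigma> t) (lam t) \<noteq> 0) \<longrightarrow>
               ((\<exists>mu. hamiltonian_system H I lam mu) \<longleftrightarrow> painleve_IV A B I (\<lambda>t. c * lam t))))))"

end

theory Submission
  imports Defs
begin

text \<open>
  Multiplication by \<open>x\<close> gives \<open>\<sigma> = x\<close>, \<open>\<tau> = 1 - s x - x\<^sup>2\<close> with \<open>s = \<surd>2 t\<close>, and a constant \<open>\<eta>\<close>,
  so that \<open>\<eta>(x) - \<eta>(\<lambda>) = 0\<close>. Thus the deformed equation is \<open>\<phi>'' + p \<phi>' + q \<phi> = 0\<close> with
  \<open>p = 1/x - s - x - 1/(x - \<lambda>)\<close> and \<open>x q = \<lambda> \<mu> (s + \<lambda> - \<mu>) + \<lambda> \<mu>/(x - \<lambda>)\<close>.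

  The compatibility functions are found as follows. Comparing the coefficients of \<open>\<phi>\<^sub>x\<close> in
  \<open>\<phi>\<^sub>x\<^sub>x\<^sub>t = \<phi>\<^sub>t\<^sub>x\<^sub>x\<close> gives \<open>a'' - (a p)' + 2 b' + p\<^sub>t = 0\<close>, which determines \<open>b\<close> up to a constant once
  \<open>a\<close> is known. The singular points \<open>0\<close> and \<open>\<infinity>\<close> do not move while \<open>\<lambda>\<close> does, which suggests
  \<open>a = c x/(x - \<lambda>)\<close>; boundedness of \<open>b\<close> at infinity forces \<open>c = \<surd>2\<close>, the rate of change of \<open>-p\<close>
  there. Integration leaves for \<open>b\<close> a simple pole at \<open>\<lambda>\<close>. Since solutions near \<open>\<lambda>\<close> have the form
  \<open>const (1 + \<mu> (x - \<lambda>) + \<dots>)\<close>, the expression \<open>a \<phi>\<^sub>x + b \<phi>\<close> is regular there exactly for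
  \<open>b = - \<surd>2 \<lambda> \<mu>/(x - \<lambda>)\<close>.

  With these \<open>a\<close> and \<open>b\<close>, the coefficient of \<open>\<phi>\<^sub>x\<close> in the compatibility condition says
  \<open>\<lambda>' = \<surd>2 \<lambda> (2 \<mu> - s - \<lambda>)\<close>; given this, the coefficient of \<open>\<phi>\<close> is a nonzero rational function of
  \<open>x\<close> times \<open>\<mu>' - \<surd>2 \<mu> (s + 2 \<lambda> - \<mu>)\<close> (\<open>compatible_at_heun_iff\<close>). These two equations are Hamilton's
  equations for \<open>H = \<surd>2 \<lambda> (\<mu>\<^sup>2 - (s + \<lambda>) \<mu>)\<close> (\<open>hamiltonian_system_ham_iff\<close>), so compatibility and the
  Hamiltonian system are equivalent (\<open>compatible_iff_hamiltonian\<close>). The first equation is linear in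
  \<open>\<mu>\<close> with the nonzero coefficient \<open>2 \<surd>2 \<lambda>\<close>, so it can be solved for \<open>\<mu>\<close>; the second one then becomes
  \<open>\<lambda>'' = \<lambda>'\<^sup>2/(2 \<lambda>) + 3 \<lambda>\<^sup>3 + 4 \<surd>2 t \<lambda>\<^sup>2 + 2 (t\<^sup>2 - 1) \<lambda>\<close>, which is Painleve IV with parameters \<open>(1, 0)\<close> for
  \<open>y = \<surd>2 \<lambda>\<close> (\<open>hamiltonian_iff_painleve_IV\<close>).
\<close>

section \<open>The deformed equation\<close>

abbreviation r2 :: complex where "r2 \<equiv> of_real (sqrt 2)"

lemma r2_sq: "r2 * r2 = 2" "r2 * (r2 * z) = 2 * z"
proof -
  show 1: "r2 * r2 = 2" by (simp flip: of_real_mult)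
  show "r2 * (r2 * z) = 2 * z" by (simp flip: mult.assoc add: 1)
qed

definition heun_sigma :: "complex poly" where
  "heun_sigma = [:0, 1:]"

definition heun_tau :: "real \<Rightarrow> complex poly" where
  "heun_tau t = [:1, - (r2 * of_real t), - 1:]"

text \<open>
  Up to the factor \<open>- \<surd>2\<close> this is the constant term \<open>\<lambda> \<mu> (s + \<lambda> - \<mu>)\<close> of \<open>x q\<close>.
\<close>

definition ham :: "complex \<Rightarrow> complex \<Rightarrow> real \<Rightarrow> complex" where
  "ham l m t = r2 * l * (m\<^sup>2 - (r2 * of_real t + l) * m)"

definition compat_a :: "complex \<Rightarrow> complex \<Rightarrow> real \<Rightarrow> complex \<Rightarrow> complex" where
  "compat_a l m t x = r2 * x / (x - l)"

definition compat_b :: "complex \<Rightarrow> complex \<Rightarrow> real \<Rightarrow> complex \<Rightarrow> complex" where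
  "compat_b l m t x = - (r2 * l * m) / (x - l)"

lemma deformed_p_heun:
  assumes "x \<noteq> 0"
  shows "deformed_p heun_sigma (heun_tau t) l x = 1 / x - r2 * of_real t - x - 1 / (x - l)"
  using assms by (simp add: deformed_p_def heun_sigma_def heun_tau_def diff_divide_distrib
      add_divide_distrib)

lemma deformed_q_heun:
  "deformed_q heun_sigma (heun_tau t) [:k:] l m x
     = (l * m * (r2 * of_real t + l - m) + m * l * (1 / (x - l))) / x"
  by (simp add: deformed_q_def heun_sigma_def heun_tau_def pderiv_pCons algebra_simps
      power2_eq_square)

section \<open>Compatibility\<close>

abbreviation heun_compatible_at ::
  "complex \<Rightarrow> (real \<Rightarrow> complex) \<Rightarrow> (real \<Rightarrow> complex) \<Rightarrow> real \<Rightarrow> complex \<Rightarrow> bool" where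
  "heun_compatible_at k lam mu t x \<equiv>
     compatible_at
       (\<lambda>t. deformed_p heun_sigma (heun_tau t) (lam t))
       (\<lambda>t. deformed_q heun_sigma (heun_tau t) [:k:] (lam t) (mu t))
       (\<lambda>t. compat_a (lam t) (mu t) t) (\<lambda>t. compat_b (lam t) (mu t) t) t x"

lemma DERIV_simple_pole:
  fixes c l x :: "'a :: real_normed_field"
  assumes "x \<noteq> l"
  shows "((\<lambda>x. c / (x - l)) has_field_derivative - c / (x - l)\<^sup>2) (at x)"
  using assms by (auto intro!: derivative_eq_intros simp: power2_eq_square)

text \<open>
  This expresses \<open>\<phi>\<^sub>x\<^sub>t = \<partial>\<^sub>x (a \<phi>\<^sub>x + b \<phi>)\<close> through \<open>\<phi>\<close> and \<open>\<phi>\<^sub>x\<close>. The double poles at \<open>\<lambda>\<close> cancel, as do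
  the poles at \<open>0\<close>, because \<open>a\<close> vanishes there.
\<close>

lemma diff_x_compat:
  fixes lam mu :: "real \<Rightarrow> complex" and k :: complex
  assumes x: "x \<noteq> 0" "x \<noteq> lam t"
  defines "l \<equiv> lam t" and "m \<equiv> mu t" and "s \<equiv> r2 * of_real t"
  defines "F \<equiv> diff_x (\<lambda>t. deformed_p heun_sigma (heun_tau t) (lam t))
       (\<lambda>t. deformed_q heun_sigma (heun_tau t) [:k:] (lam t) (mu t))
       ((\<lambda>t. compat_b (lam t) (mu t) t), (\<lambda>t. compat_a (lam t) (mu t) t))"
  shows "fst F t x = - (r2 * l * m * (s + l - m)) / (x - l)"
    and "snd F t x = r2 * (x + s + l + l * (s + l - m) / (x - l))"
proof -
  have z: "x - l \<noteq> 0" using x by (simp add: l_def)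
  have "(compat_a l m t has_field_derivative - (r2 * l) / (x - l)\<^sup>2) (at x)"
    unfolding compat_a_def using z
    by (auto intro!: derivative_eq_intros simp: field_simps power2_eq_square)
  then have da: "deriv (compat_a l m t) x = - (r2 * l) / (x - l)\<^sup>2" by (rule DERIV_imp_deriv)
  have "(compat_b l m t has_field_derivative r2 * l * m / (x - l)\<^sup>2) (at x)"
    unfolding compat_b_def using DERIV_simple_pole[of x l "- (r2 * l * m)"] z by simp
  then have db: "deriv (compat_b l m t) x = r2 * l * m / (x - l)\<^sup>2" by (rule DERIV_imp_deriv)
  show "fst F t x = - (r2 * l * m * (s + l - m)) / (x - l)"
    unfolding F_def diff_x_def using x z
    by (simp add: deformed_q_heun db flip: l_def m_def s_def)
      (simp add: compat_a_def divide_simps, simp add: algebra_simps power2_eq_square)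
  show "snd F t x = r2 * (x + s + l + l * (s + l - m) / (x - l))"
    unfolding F_def diff_x_def using x z
    by (simp add: deformed_p_heun da flip: l_def m_def s_def)
      (simp add: compat_a_def compat_b_def divide_simps, simp add: algebra_simps power2_eq_square)
qed

lemma has_vector_derivative_r2_of_real:
  "((\<lambda>s. r2 * of_real s) has_vector_derivative r2) (at t)"
proof -
  have "(complex_of_real has_vector_derivative 1) (at t)"
    by (auto simp: has_vector_derivative_def intro!: derivative_eq_intros simp: scaleR_conv_of_real)
  from has_vector_derivative_mult_right[OF this, of r2] show ?thesis by simp
qed

lemma has_vector_derivative_inverse_diff:
  fixes lam :: "real \<Rightarrow> complex"
  assumes "(lam has_vector_derivative L) (at t)" "x \<noteq> lam t"
  shows "((\<lambda>s. 1 / (x - lam s)) has_vector_derivative L / (x - lam t)\<^sup>2) (at t)"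
proof -
  have "((\<lambda>l. 1 / (x - l)) has_field_derivative 1 / (x - lam t)\<^sup>2) (at (lam t))"
    using assms(2) by (auto intro!: derivative_eq_intros simp: field_simps power2_eq_square)
  from field_vector_diff_chain_at[OF assms(1) this] show ?thesis by (simp add: o_def)
qed

text \<open>
  The two conjuncts come from the coefficients of \<open>\<phi>\<^sub>x\<close> and of \<open>\<phi>\<close>. The second coefficient factors in
  this way only after the equation for \<open>L\<close> has been substituted.
\<close>

lemma compatible_at_heun_iff:
  fixes lam mu :: "real \<Rightarrow> complex"
  assumes lam: "(lam has_vector_derivative L) (at t)" and mu: "(mu has_vector_derivative M) (at t)"
    and x: "x \<noteq> 0" "x \<noteq> lam t" and l0: "lam t \<noteq> 0"
  defines "l \<equiv> lam t" and "m \<equiv> mu t" and "s \<equiv> r2 * of_real t"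
  shows "heun_compatible_at k lam mu t x
    \<longleftrightarrow> L = r2 * l * (2 * m - s - l) \<and>
        (M - r2 * m * (s + 2 * l - m)) * ((s + l - 2 * m) * (x - l) + 1) = 0"
proof -
  let ?p = "\<lambda>t. deformed_p heun_sigma (heun_tau t) (lam t)"
  let ?q = "\<lambda>t. deformed_q heun_sigma (heun_tau t) [:k:] (lam t) (mu t)"
  let ?a = "\<lambda>t. compat_a (lam t) (mu t) t" and ?b = "\<lambda>t. compat_b (lam t) (mu t) t"
  have z: "x - l \<noteq> 0" "x \<noteq> l" and l: "l \<noteq> 0" using x l0 by (auto simp: l_def)
  have p: "?p t x = 1 / x - s - x - 1 / (x - l)"
    using x by (simp add: deformed_p_heun l_def s_def)
  have q: "?q t x = (l * m * (s + l - m) + m * l * (1 / (x - l))) / x"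
    by (simp add: deformed_q_heun l_def m_def s_def)
  note inv = has_vector_derivative_inverse_diff[OF lam x(2)]
  have pt: "((\<lambda>u. - ?p u x) has_vector_derivative r2 + L / (x - l)\<^sup>2) (at t)"
    using x by (simp add: deformed_p_heun l_def)
      (auto intro!: derivative_eq_intros has_vector_derivative_r2_of_real inv)
  \<comment> \<open>the \<open>t\<close>-derivative of the constant term \<open>\<lambda> \<mu> (s + \<lambda> - \<mu>)\<close> of \<open>x q\<close>\<close>
  define C' where "C' = (L * m + l * M) * (s + l - m) + l * m * (r2 + L - M)"
  have qt: "((\<lambda>u. - ?q u x) has_vector_derivative
      - ((C' + (M * l + m * L) * (1 / (x - l)) + m * l * (L / (x - l)\<^sup>2)) / x)) (at t)"
    unfolding deformed_q_heun
    by (rule has_vector_derivative_eq_rhs,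
        (rule has_vector_derivative_minus has_vector_derivative_divide has_vector_derivative_add
          has_vector_derivative_diff has_vector_derivative_r2_of_real inv lam mu
          has_vector_derivative_mult)+)
      (simp add: C'_def l_def m_def s_def algebra_simps add_divide_distrib)
  define F where "F = diff_x ?p ?q (?b, ?a)"
  define f1 where "f1 = (\<lambda>x. - (r2 * l * m * (s + l - m)) / (x - l))"
  define g1 where "g1 = (\<lambda>x. r2 * (x + s + l + l * (s + l - m) / (x - l)))"
  have F: "fst F t y = f1 y" "snd F t y = g1 y" if "y \<noteq> 0" "y \<noteq> l" for y
    using diff_x_compat[of y lam t k mu] that by (simp_all add: F_def l_def m_def s_def f1_def g1_def)
  \<comment> \<open>\<open>F\<close> agrees with its explicit form only off the singular points, which is an open
    condition and so suffices for differentiating once more.\<close>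
  have op: "open (- {0, l})" by (simp add: open_Compl)
  have xin: "x \<in> - {0, l}" using x by (simp add: l_def)
  have "(f1 has_field_derivative r2 * l * m * (s + l - m) / (x - l)\<^sup>2) (at x)"
    unfolding f1_def using DERIV_simple_pole[OF z(2), of "- (r2 * l * m * (s + l - m))"] by simp
  then have "(fst F t has_field_derivative r2 * l * m * (s + l - m) / (x - l)\<^sup>2) (at x)"
    by (rule has_field_derivative_transform_within_open[OF _ op xin]) (simp add: F)
  then have df: "deriv (fst F t) x = r2 * l * m * (s + l - m) / (x - l)\<^sup>2" by (rule DERIV_imp_deriv)
  have "(g1 has_field_derivative r2 * (1 - l * (s + l - m) / (x - l)\<^sup>2)) (at x)"
    unfolding g1_def
    by (rule derivative_eq_intros refl DERIV_simple_pole[OF z(2)])+ simp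
  then have "(snd F t has_field_derivative r2 * (1 - l * (s + l - m) / (x - l)\<^sup>2)) (at x)"
    by (rule has_field_derivative_transform_within_open[OF _ op xin]) (simp add: F)
  then have dg: "deriv (snd F t) x = r2 * (1 - l * (s + l - m) / (x - l)\<^sup>2)" by (rule DERIV_imp_deriv)
  have iff: "compatible_at ?p ?q ?a ?b t x \<longleftrightarrow>
     - ((C' + (M * l + m * L) * (1 / (x - l)) + m * l * (L / (x - l)\<^sup>2)) / x)
        - ?q t x * ?b t x - ?p t x * f1 x
       = r2 * l * m * (s + l - m) / (x - l)\<^sup>2 - ?q t x * g1 x \<and>
     r2 + L / (x - l)\<^sup>2 - ?q t x * ?a t x - ?p t x * g1 x
       = r2 * (1 - l * (s + l - m) / (x - l)\<^sup>2) + f1 x - ?p t x * g1 x"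
    unfolding compatible_at_def Let_def diff_t_def
    unfolding F_def[symmetric] diff_x_def[of ?p ?q F]
    using vector_derivative_at[OF pt] vector_derivative_at[OF qt] x
    by (simp add: split_beta F df dg flip: l_def)
  have e2: "r2 + L / (x - l)\<^sup>2 - ?q t x * ?a t x - ?p t x * g1 x
       - (r2 * (1 - l * (s + l - m) / (x - l)\<^sup>2) + f1 x - ?p t x * g1 x)
     = (L - r2 * l * (2 * m - s - l)) / (x - l)\<^sup>2"
    unfolding q compat_a_def f1_def unfolding l_def[symmetric] using z x(1)
    by (simp add: divide_simps) (simp add: algebra_simps power2_eq_square)
  have e1: "- ((C' + (M * l + m * L) * (1 / (x - l)) + m * l * (L / (x - l)\<^sup>2)) / x)
        - ?q t x * ?b t x - ?p t x * f1 x
       - (r2 * l * m * (s + l - m) / (x - l)\<^sup>2 - ?q t x * g1 x)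
     = - l * ((M - r2 * m * (s + 2 * l - m)) * ((s + l - 2 * m) * (x - l) + 1)) / (x * (x - l))"
    if L: "L = r2 * l * (2 * m - s - l)"
    unfolding p q compat_b_def f1_def g1_def C'_def L
    unfolding l_def[symmetric] m_def[symmetric] using z x(1)
    by (simp add: divide_simps) (simp add: algebra_simps power2_eq_square)
  show ?thesis
    unfolding iff
    using e1 e2 z x(1) l
    by (smt (verit)
        divide_eq_0_iff eq_iff_diff_eq_0 mult_eq_0_iff neg_equal_0_iff_equal power_not_zero)
qed

section \<open>The Hamiltonian system\<close>

lemma hamiltonian_system_ham_iff:
  "hamiltonian_system ham I lam mu \<longleftrightarrow>
     (\<forall>t\<in>I. (lam has_vector_derivative r2 * lam t * (2 * mu t - r2 * of_real t - lam t)) (at t) \<and>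
            (mu has_vector_derivative r2 * mu t * (r2 * of_real t + 2 * lam t - mu t)) (at t))"
proof -
  have l: "((\<lambda>l. ham l (mu t) t) has_field_derivative
      - (r2 * mu t * (r2 * of_real t + 2 * lam t - mu t))) (at (lam t))" for t
    unfolding ham_def by (auto intro!: derivative_eq_intros simp: algebra_simps power2_eq_square)
  have m: "((\<lambda>m. ham (lam t) m t) has_field_derivative
      r2 * lam t * (2 * mu t - r2 * of_real t - lam t)) (at (mu t))" for t
    unfolding ham_def by (auto intro!: derivative_eq_intros simp: algebra_simps power2_eq_square)
  show ?thesis
    unfolding hamiltonian_system_def
    using DERIV_unique[OF l] DERIV_unique[OF m] l m by (metis minus_minus)
qed

text \<open>
  For fixed \<open>t\<close>, the factor \<open>(s + \<lambda> - 2 \<mu>) (x - \<lambda>) + 1\<close> of \<open>compatible_at_heun_iff\<close> is a polynomial in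
  \<open>x\<close> of degree at most one with value \<open>1\<close> at \<open>\<lambda>\<close>, hence has at most one zero. So compatibility at two
  regular points already yields both of Hamilton's equations.
\<close>

lemma compatible_iff_hamiltonian:
  assumes "\<forall>t\<in>I. lam t \<noteq> 0"
    and "\<forall>t\<in>I. lam differentiable at t \<and> mu differentiable at t"
  shows "(\<forall>t\<in>I. \<forall>x. x \<noteq> 0 \<longrightarrow> x \<noteq> lam t \<longrightarrow> heun_compatible_at k lam mu t x)
         \<longleftrightarrow> hamiltonian_system ham I lam mu"
  unfolding hamiltonian_system_ham_iff
proof (intro ball_cong refl)
  fix t assume t: "t \<in> I"
  define l m s where "l = lam t" and "m = mu t" and "s = r2 * of_real t"
  have l: "l \<noteq> 0" using assms(1) t by (simp add: l_def)
  obtain L M where L: "(lam has_vector_derivative L) (at t)" and M: "(mu has_vector_derivative M) (at t)"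
    using assms(2) t by (meson vector_derivative_works)
  have "(\<forall>x. x \<noteq> 0 \<longrightarrow> x \<noteq> lam t \<longrightarrow> heun_compatible_at k lam mu t x)
     \<longleftrightarrow> (\<forall>x. x \<noteq> 0 \<longrightarrow> x \<noteq> l \<longrightarrow> L = r2 * l * (2 * m - s - l) \<and>
            (M - r2 * m * (s + 2 * l - m)) * ((s + l - 2 * m) * (x - l) + 1) = 0)"
    using compatible_at_heun_iff[OF L M] l unfolding l_def m_def s_def by blast
  also have "\<dots> \<longleftrightarrow> L = r2 * l * (2 * m - s - l) \<and> M = r2 * m * (s + 2 * l - m)"
  proof
    assume *: "\<forall>x. x \<noteq> 0 \<longrightarrow> x \<noteq> l \<longrightarrow> L = r2 * l * (2 * m - s - l) \<and>
            (M - r2 * m * (s + 2 * l - m)) * ((s + l - 2 * m) * (x - l) + 1) = 0"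
    \<comment> \<open>\<open>2 \<lambda>\<close> and \<open>3 \<lambda>\<close> are two points different from \<open>0\<close> and \<open>\<lambda>\<close>.\<close>
    define D j where "D = M - r2 * m * (s + 2 * l - m)" and "j = (s + l - 2 * m) * l"
    have "D * (j + 1) = 0" "D * (2 * j + 1) = 0"
      using *[rule_format, of "2 * l"] *[rule_format, of "3 * l"] l
      by (simp_all add: D_def j_def algebra_simps)
    moreover have "D = 2 * (D * (j + 1)) - D * (2 * j + 1)" by (simp add: algebra_simps)
    ultimately have "D = 0" by (metis diff_0_right mult_zero_right)
    then show "L = r2 * l * (2 * m - s - l) \<and> M = r2 * m * (s + 2 * l - m)"
      using *[rule_format, of "2 * l"] l by (simp add: D_def)
  qed simp
  also have "\<dots> \<longleftrightarrow> (lam has_vector_derivative r2 * l * (2 * m - s - l)) (at t) \<and>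
            (mu has_vector_derivative r2 * m * (s + 2 * l - m)) (at t)"
    using L M vector_derivative_unique_at by blast
  finally show "(\<forall>x. x \<noteq> 0 \<longrightarrow> x \<noteq> lam t \<longrightarrow> heun_compatible_at k lam mu t x)
     \<longleftrightarrow> (lam has_vector_derivative r2 * lam t * (2 * mu t - r2 * of_real t - lam t)) (at t) \<and>
            (mu has_vector_derivative r2 * mu t * (r2 * of_real t + 2 * lam t - mu t)) (at t)"
    by (simp add: l_def m_def s_def)
qed

section \<open>Elimination of \<open>\<mu>\<close>\<close>

text \<open>
  Let \<open>d = 2 \<mu> - s - \<lambda>\<close>. The first of Hamilton's equations reads \<open>\<lambda>' = \<surd>2 \<lambda> d\<close>, so that \<open>y = \<surd>2 \<lambda>\<close>
  satisfies \<open>y' = 2 \<lambda> d\<close>. Differentiating this relation and inserting the second equation gives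
  Painleve IV. Conversely, a solution \<open>y\<close> of Painleve IV determines \<open>d = y'/(2 \<lambda>)\<close> and with it \<open>\<mu>\<close>.
\<close>

lemma hamiltonian_iff_painleve_IV:
  assumes nz: "\<forall>t\<in>I. lam t \<noteq> 0"
  shows "(\<exists>mu. hamiltonian_system ham I lam mu) \<longleftrightarrow> painleve_IV 1 0 I (\<lambda>t. r2 * lam t)"
proof
  assume "\<exists>mu. hamiltonian_system ham I lam mu"
  then obtain mu where
    L: "\<And>t. t \<in> I \<Longrightarrow>
      (lam has_vector_derivative r2 * lam t * (2 * mu t - r2 * of_real t - lam t)) (at t)" and
    M: "\<And>t. t \<in> I \<Longrightarrow>
      (mu has_vector_derivative r2 * mu t * (r2 * of_real t + 2 * lam t - mu t)) (at t)"
    unfolding hamiltonian_system_ham_iff by blast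
  define d where "d = (\<lambda>t. 2 * mu t - r2 * of_real t - lam t)"
  define y' where "y' = (\<lambda>t. 2 * (lam t * d t))"
  define d' where "d' = (\<lambda>t. 2 * (r2 * mu t * (r2 * of_real t + 2 * lam t - mu t)) - r2 - r2 * lam t * d t)"
  define y'' where "y'' = (\<lambda>t. 2 * (lam t * d' t + r2 * lam t * d t * d t))"
  show "painleve_IV 1 0 I (\<lambda>t. r2 * lam t)"
    unfolding painleve_IV_def
  proof (rule exI[of _ y'], rule exI[of _ y''], intro ballI conjI)
    fix t assume t: "t \<in> I"
    then have l: "lam t \<noteq> 0" using nz by blast
    then show "r2 * lam t \<noteq> 0" by simp
    have L': "(lam has_vector_derivative r2 * lam t * d t) (at t)" using L[OF t] by (simp add: d_def)
    have D': "(d has_vector_derivative d' t) (at t)"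
      unfolding d_def d'_def
      by (auto intro!: derivative_eq_intros L[OF t] M[OF t]
          has_vector_derivative_r2_of_real)
    show "((\<lambda>t. r2 * lam t) has_vector_derivative y' t) (at t)"
      using has_vector_derivative_mult_right[OF L', of r2] by (simp add: y'_def r2_sq mult.assoc)
    show "(y' has_vector_derivative y'' t) (at t)"
      using has_vector_derivative_mult_right[OF has_vector_derivative_mult[OF L' D'], of 2]
      by (simp only: y'_def y''_def)
    show "y'' t = 1 / (2 * (r2 * lam t)) * (y' t)\<^sup>2 + 3 / 2 * (r2 * lam t) ^ 3 +
         4 * complex_of_real t * (r2 * lam t)\<^sup>2 +
         2 * ((complex_of_real t)\<^sup>2 - 1) * (r2 * lam t) + 0 / (r2 * lam t)"
      using l
      by (simp add: y'_def y''_def d'_def d_def field_simps power2_eq_square power3_eq_cube)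
         (simp add: algebra_simps r2_sq)
  qed
next
  assume "painleve_IV 1 0 I (\<lambda>t. r2 * lam t)"
  then obtain y' y'' where
    Y: "\<And>t. t \<in> I \<Longrightarrow> ((\<lambda>t. r2 * lam t) has_vector_derivative y' t) (at t)" and
    Y': "\<And>t. t \<in> I \<Longrightarrow> (y' has_vector_derivative y'' t) (at t)" and
    Y'': "\<And>t. t \<in> I \<Longrightarrow> y'' t = 1 / (2 * (r2 * lam t)) * (y' t)\<^sup>2 + 3 / 2 * (r2 * lam t) ^ 3 +
         4 * complex_of_real t * (r2 * lam t)\<^sup>2 +
         2 * ((complex_of_real t)\<^sup>2 - 1) * (r2 * lam t) + 0 / (r2 * lam t)"
    unfolding painleve_IV_def by blast
  define d where "d = (\<lambda>t. y' t * (1 / lam t) / 2)"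
  define mu where "mu = (\<lambda>t. (d t + r2 * of_real t + lam t) / 2)"
  have "hamiltonian_system ham I lam mu"
    unfolding hamiltonian_system_ham_iff
  proof (intro ballI conjI)
    fix t assume t: "t \<in> I"
    then have l: "lam t \<noteq> 0" using nz by blast
    have y': "y' t = 2 * lam t * d t" using l by (simp add: d_def)
    have L': "(lam has_vector_derivative r2 * lam t * d t) (at t)"
      using has_vector_derivative_mult_right[OF Y[OF t], of "r2 / 2"]
      by (simp add: y' r2_sq mult.assoc)
    have "((\<lambda>l. 1 / l) has_field_derivative - (1 / (lam t)\<^sup>2)) (at (lam t))"
      using l by (auto intro!: derivative_eq_intros simp: field_simps power2_eq_square)
    from field_vector_diff_chain_at[OF L' this]
    have inv: "((\<lambda>t. 1 / lam t) has_vector_derivative - (r2 * d t / lam t)) (at t)"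
      using l by (simp add: o_def field_simps power2_eq_square)
    \<comment> \<open>Painleve IV for \<open>y\<close> is the equation for \<open>d'\<close> that \<open>2 \<mu>' = d' + s' + \<lambda>'\<close> requires.\<close>
    have "(d has_vector_derivative (y' t * - (r2 * d t / lam t) + y'' t * (1 / lam t)) / 2) (at t)"
      using has_vector_derivative_divide[OF has_vector_derivative_mult[OF Y'[OF t] inv], of 2]
      by (simp only: d_def[abs_def])
    moreover have "(y' t * - (r2 * d t / lam t) + y'' t * (1 / lam t)) / 2
        = 2 * (r2 * mu t * (r2 * of_real t + 2 * lam t - mu t)) - r2 - r2 * lam t * d t"
      unfolding Y''[OF t] y' using l
      by (simp add: mu_def field_simps power2_eq_square power3_eq_cube)
         (simp add: algebra_simps r2_sq)
    ultimately have D': "(d has_vector_derivative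
        2 * (r2 * mu t * (r2 * of_real t + 2 * lam t - mu t)) - r2 - r2 * lam t * d t) (at t)"
      by (simp only:)
    show "(lam has_vector_derivative r2 * lam t * (2 * mu t - r2 * of_real t - lam t)) (at t)"
    proof -
      have "2 * mu t - r2 * of_real t - lam t = d t" by (simp add: mu_def field_simps)
      then show ?thesis using L' by simp
    qed
    have "(mu has_vector_derivative
       ((2 * (r2 * mu t * (r2 * of_real t + 2 * lam t - mu t)) - r2 - r2 * lam t * d t)
         + r2 + r2 * lam t * d t) / 2) (at t)"
      using has_vector_derivative_divide[OF has_vector_derivative_add[OF has_vector_derivative_add[OF
            D' has_vector_derivative_r2_of_real] L'], of 2]
      by (simp only: mu_def[abs_def])
    then show "(mu has_vector_derivative r2 * mu t * (r2 * of_real t + 2 * lam t - mu t)) (at t)"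
      by simp
  qed
  then show "\<exists>mu. hamiltonian_system ham I lam mu" by blast
qed

section \<open>The bi-confluent Heun equation\<close>

lemma polynomial_form_heun:
  "polynomial_form (\<lambda>t x. - (- (1 / x) + of_real (sqrt 2 * t) + x)) (\<lambda>t x. k / x)
     (\<lambda>t. heun_sigma) heun_tau (\<lambda>t. [:k:])"
  unfolding polynomial_form_def
  by (auto simp: heun_sigma_def heun_tau_def field_simps)

theorem theorem5p1:
  fixes n :: nat
  assumes "n \<ge> 1"
  shows "isomonodromic_painleve_IV
           (\<lambda>t x. - (- (1 / x) + of_real (sqrt 2 * t) + x))
           (\<lambda>t x. of_real (4 * sqrt 3 * real n powr (3 / 2)) / (9 * x))"
proof -
  define k :: complex where "k = of_real (4 * sqrt 3 * real n powr (3 / 2)) / 9"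
  have q: "(\<lambda>t x. of_real (4 * sqrt 3 * real n powr (3 / 2)) / (9 * x)) = (\<lambda>(t::real) x. k / x)"
    by (simp add: k_def)
  have sig: "poly heun_sigma x \<noteq> 0 \<longleftrightarrow> x \<noteq> 0" for x by (simp add: heun_sigma_def)
  have ra: "rational_on {x. x \<noteq> 0 \<and> x \<noteq> l} (compat_a l m t)" for l m t
    unfolding rational_on_def
    by (rule exI[of _ "[:0, r2:]"], rule exI[of _ "[:- l, 1:]"])
      (simp add: compat_a_def mult.commute)
  have rb: "rational_on {x. x \<noteq> 0 \<and> x \<noteq> l} (compat_b l m t)" for l m t
    unfolding rational_on_def
    by (rule exI[of _ "[:- (r2 * l * m):]"], rule exI[of _ "[:- l, 1:]"])
      (simp add: compat_b_def)
  show ?thesis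
    unfolding isomonodromic_painleve_IV_def q
  proof (rule exI[of _ "\<lambda>t. heun_sigma"], rule exI[of _ heun_tau], rule exI[of _ "\<lambda>t. [:k:]"],
      rule conjI[OF polynomial_form_heun],
      rule exI[of _ compat_a], rule exI[of _ compat_b], rule exI[of _ ham],
      unfold sig, intro conjI)
    show "\<forall>l m (t::real). l \<noteq> 0 \<longrightarrow>
        rational_on {x. x \<noteq> 0 \<and> x \<noteq> l} (compat_a l m t) \<and>
        rational_on {x. x \<noteq> 0 \<and> x \<noteq> l} (compat_b l m t)"
      using ra rb by blast
    show "\<forall>I lam mu. open I \<longrightarrow> (\<forall>t\<in>I. lam t \<noteq> 0) \<longrightarrow>
        (\<forall>t\<in>I. lam differentiable at t \<and> mu differentiable at t) \<longrightarrow>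
        ((\<forall>t\<in>I. \<forall>x. x \<noteq> 0 \<longrightarrow> x \<noteq> lam t \<longrightarrow> heun_compatible_at k lam mu t x)
          \<longleftrightarrow> hamiltonian_system ham I lam mu)"
      using compatible_iff_hamiltonian by blast
    show "\<exists>A B c. c \<noteq> 0 \<and>
        (\<forall>I lam. open I \<longrightarrow> (\<forall>t\<in>I. lam t \<noteq> 0) \<longrightarrow>
          ((\<exists>mu. hamiltonian_system ham I lam mu) \<longleftrightarrow> painleve_IV A B I (\<lambda>t. c * lam t)))"
      using hamiltonian_iff_painleve_IV
      by - (rule exI[of _ 1], rule exI[of _ 0], rule exI[of _ r2], simp)
  qed
qed

end
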